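(* Every $10$-tough (finite, simple, connected, nonempty) graph is resistance positive (RP).
   Context: All graphs are finite, simple and connected, with at least one vertex. For a graph $G$ and $S\subseteq V(G)$, let $c(G-S)$ be the number of connected components of $G-S$. The toughness of a noncomplete graph $G$ is $\tau(G):=\min\{|S|/c(G-S): S\subseteq V(G),\ c(G-S)>1\}$; complete graphs have infinite toughness. $G$ is $t$-tough if $\tau(G)\ge t$. Resistance curvature: let $G=(V,E)$ be a finite simple connected graph, $\mathcal T(G)$ its set of spanning trees, and $c=(c_e)_{e\in E}$ positive edge weights. The relative resistance of an edge $e$ is $$r_e(c):=\frac{\sum_{T\in\mathcal T(G),\, e\in T}\prod_{h\in T}c_h}{\sum_{T\in\mathcal T(G)}\prod_{h\in T}c_h}$$ (equivalently $c_e$ times the effective resistance between the ends of $e$), and the resistance curvature of a vertex $v$ is $p_v(c):=1-\frac12\sum_{e\ni v}r_e(c)$. $G$ is resistance positive (RP) if there exist positive edge weights $c$ with $p_v(c)>0$ for every $v\in V$. *)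

theory Defs
  imports "HOL-Library.Extended_Real" "Graph_Theory.Graph_Theory"
begin

text \<open>
  A finite simple graph is a \<open>pair_graph\<close>: a finite, loop-free digraph whose arc relation is
  symmetric.  Both orientations of an undirected edge are arcs, so edges are recovered as
  two-element vertex sets.
\<close>

definition uedges :: "'a pair_pre_digraph \<Rightarrow> 'a set set" where
  "uedges G = {{u, v} | u v. (u, v) \<in> parcs G}"


subsection \<open>Toughness\<close>

text \<open>In a symmetric digraph the strongly connected components are the connected components.\<close>

definition num_components :: "('a, 'b) pre_digraph \<Rightarrow> nat" where
  "num_components G = card (pre_digraph.sccs G)"

definition del_verts :: "'a pair_pre_digraph \<Rightarrow> 'a set \<Rightarrow> ('a, 'a \<times> 'a) pre_digraph" where
  "del_verts G S = with_proj G \<restriction> (pverts G - S)"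

definition complete_graph :: "'a pair_pre_digraph \<Rightarrow> bool" where
  "complete_graph G \<longleftrightarrow> complete_digraph (card (pverts G)) (with_proj G)"

definition toughness :: "'a pair_pre_digraph \<Rightarrow> ereal" where
  "toughness G =
    (if complete_graph G then \<infinity>
     else Min {ereal (real (card S) / real (num_components (del_verts G S))) | S.
                 S \<subseteq> pverts G \<and> num_components (del_verts G S) > 1})"

definition tough :: "real \<Rightarrow> 'a pair_pre_digraph \<Rightarrow> bool" where
  "tough t G \<longleftrightarrow> toughness G \<ge> ereal t"


subsection \<open>Spanning trees\<close>

definition spanning_subgraph :: "'a pair_pre_digraph \<Rightarrow> 'a set set \<Rightarrow> 'a pair_pre_digraph" where
  "spanning_subgraph G F = \<lparr>pverts = pverts G, parcs = {(u, v). {u, v} \<in> F}\<rparr>"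

text \<open>
  The constants \<open>forest\<close> and \<open>spanning_tree\<close> of \<open>Digraph_Component\<close> refer to directed cycles:
  they reject every edge present in both orientations and accept acyclically oriented
  undirected cycles.  In a loop-free symmetric digraph the undirected cycles are
  the directed cycles of length at least 3.
\<close>

definition undirected_acyclic :: "'a pair_pre_digraph \<Rightarrow> bool" where
  "undirected_acyclic H \<longleftrightarrow> \<not> (\<exists>p. pre_digraph.cycle (with_proj H) p \<and> length p \<ge> 3)"

text \<open>A spanning tree is represented by its set of edges.\<close>

definition spanning_trees :: "'a pair_pre_digraph \<Rightarrow> 'a set set set" where
  "spanning_trees G =
    {T. T \<subseteq> uedges G \<and> Digraph_Component.connected (with_proj (spanning_subgraph G T)) \<and>
        undirected_acyclic (spanning_subgraph G T)}"


subsection \<open>Resistance curvature\<close>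

definition relative_resistance ::
    "'a pair_pre_digraph \<Rightarrow> ('a set \<Rightarrow> real) \<Rightarrow> 'a set \<Rightarrow> real" where
  "relative_resistance G c e =
    (\<Sum>T \<in> {T \<in> spanning_trees G. e \<in> T}. \<Prod>h\<in>T. c h) / (\<Sum>T \<in> spanning_trees G. \<Prod>h\<in>T. c h)"

definition resistance_curvature ::
    "'a pair_pre_digraph \<Rightarrow> ('a set \<Rightarrow> real) \<Rightarrow> 'a \<Rightarrow> real" where
  "resistance_curvature G c v =
    1 - (1 / 2) * (\<Sum>e \<in> {e \<in> uedges G. v \<in> e}. relative_resistance G c e)"

definition resistance_positive :: "'a pair_pre_digraph \<Rightarrow> bool" where
  "resistance_positive G \<longleftrightarrow>
    (\<exists>c. (\<forall>e \<in> uedges G. c e > 0) \<and> (\<forall>v \<in> pverts G. resistance_curvature G c v > 0))"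

end

theory Submission
  imports Defs "HOL-Analysis.Analysis"
begin

text \<open>
  Toughness 2 already suffices.  Give an edge \<open>{u, v}\<close> the weight \<open>exp (- l u - l v)\<close> for a vertex
  function \<open>l \<ge> 0\<close>.  A spanning tree \<open>T\<close> then has weight \<open>exp (- (\<Sum>v. l v * deg T v))\<close>, and the
  partial derivatives of \<open>\<Psi> l = ln (\<Sum>T. exp (\<Sum>v. l v * (2 - deg T v)))\<close> are twice the resistance
  curvatures.  If every \<open>l \<ge> 0\<close> admits a spanning tree with
  \<open>(\<Sum>v. l v * (2 - deg T v)) \<ge> Max l\<close>, then \<open>\<Psi> l - \<epsilon> * (\<Sum>v. l v)\<close> is coercive on the
  nonnegative orthant for small \<open>\<epsilon> > 0\<close>, and at a minimum there all curvatures are at least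
  \<open>\<epsilon> / 2\<close>.

  Such a tree is grown along increasing \<open>l\<close>: every new vertex is attached to its cheapest earlier
  neighbour, and then to the remaining components it touches.  The savings of the first kind of
  edges pay for the second kind because an initial segment \<open>U\<close> of the vertices, whose outer boundary
  separates the components of \<open>G[U]\<close> from each other, has a boundary of at least \<open>2 * c - 1\<close>
  vertices if \<open>G[U]\<close> has \<open>c\<close> components.
\<close>

subsection \<open>Forests as edge sets\<close>

text \<open>The closure is taken over the whole type, so a vertex on no edge is its own class and no
  vertex set has to be carried along. \<open>components\<close> then selects the classes that meet
  \<open>U\<close>.\<close>

definition joined :: "'a set set \<Rightarrow> ('a \<times> 'a) set" where
  "joined F = {(u, v). {u, v} \<in> F}\<^sup>*"

definition components :: "'a set set \<Rightarrow> 'a set \<Rightarrow> 'a set set" where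
  "components F U = (\<lambda>u. joined F `` {u}) ` U"

text \<open>
  Every edge joins two different components at the moment it is added; this gives both the
  edge count and acyclicity without talking about cycles.
\<close>

inductive edge_forest :: "'a set set \<Rightarrow> bool" where
  empty: "edge_forest {}"
| insert: "edge_forest F \<Longrightarrow> (u, v) \<notin> joined F \<Longrightarrow> edge_forest (insert {u, v} F)"

lemma joined_refl [simp, intro]: "(u, u) \<in> joined F"
  by (simp add: joined_def)

lemma joined_sym: "(u, v) \<in> joined F \<Longrightarrow> (v, u) \<in> joined F"
  unfolding joined_def
  by (rule symD[OF sym_rtrancl]) (auto simp: sym_def insert_commute)

lemma joined_trans: "(u, v) \<in> joined F \<Longrightarrow> (v, w) \<in> joined F \<Longrightarrow> (u, w) \<in> joined F"
  unfolding joined_def by (rule rtrancl_trans)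

lemma joined_edge: "{u, v} \<in> F \<Longrightarrow> (u, v) \<in> joined F"
  unfolding joined_def by auto

lemma joined_subset:
  assumes "\<And>u v. {u, v} \<in> F \<Longrightarrow> (u, v) \<in> joined F'"
  shows "joined F \<subseteq> joined F'"
proof (rule subrelI)
  fix x y assume "(x, y) \<in> joined F"
  then show "(x, y) \<in> joined F'" unfolding joined_def[of F]
    by (induction rule: rtrancl_induct) (auto intro: joined_trans assms)
qed

lemma joined_mono: "F \<subseteq> F' \<Longrightarrow> joined F \<subseteq> joined F'"
  by (rule joined_subset) (auto intro: joined_edge)

lemma joined_closed:
  assumes "(x, y) \<in> joined F" "x \<in> S" "\<And>u v. {u, v} \<in> F \<Longrightarrow> u \<in> S \<Longrightarrow> v \<in> S"
  shows "y \<in> S"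
  using assms(1) unfolding joined_def by (induction rule: rtrancl_induct) (use assms in auto)

lemma joined_class_eq_iff: "joined F `` {u} = joined F `` {v} \<longleftrightarrow> (u, v) \<in> joined F"
  by (auto intro: joined_sym joined_trans)

text \<open>The right side contains \<open>x\<close> and is closed under the edges of the enlarged
  set, so no path from \<open>x\<close> leaves it.\<close>

lemma joined_insert_class:
  "joined (insert {u, v} F) `` {x} =
    (if (x, u) \<in> joined F \<or> (x, v) \<in> joined F then joined F `` {u} \<union> joined F `` {v}
     else joined F `` {x})" (is "?L = ?R")
proof
  show "?L \<subseteq> ?R"
  proof
    fix y assume "y \<in> ?L"
    then have "(x, y) \<in> joined (insert {u, v} F)" by simp
    then show "y \<in> ?R"
    proof (rule joined_closed)
      show "x \<in> ?R" by (auto intro: joined_sym)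
      fix p q assume "{p, q} \<in> insert {u, v} F" "p \<in> ?R"
      then consider "(p, q) \<in> joined F" | "p = u" "q = v" | "p = v" "q = u"
        by (auto simp: doubleton_eq_iff intro: joined_edge)
      then show "q \<in> ?R"
        using \<open>p \<in> ?R\<close> by cases (auto split: if_splits intro: joined_trans joined_sym)
    qed
  qed
  have sub: "joined F \<subseteq> joined (insert {u, v} F)" by (rule joined_mono) auto
  have uv: "(u, v) \<in> joined (insert {u, v} F)" by (rule joined_edge) simp
  show "?R \<subseteq> ?L"
  proof
    fix y assume y: "y \<in> ?R"
    show "y \<in> ?L"
    proof (cases "(x, u) \<in> joined F \<or> (x, v) \<in> joined F")
      case True
      then have "(x, u) \<in> joined (insert {u, v} F)" "(x, v) \<in> joined (insert {u, v} F)"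
        using sub uv joined_sym[OF uv] by (meson joined_trans subsetD)+
      moreover have "(u, y) \<in> joined (insert {u, v} F) \<or> (v, y) \<in> joined (insert {u, v} F)"
        using y True sub by auto
      ultimately show ?thesis using joined_trans by auto
    next
      case False
      with y sub show ?thesis by auto
    qed
  qed
qed

lemma finite_edge_forest: "edge_forest F \<Longrightarrow> finite F"
  by (induction rule: edge_forest.induct) auto

text \<open>Each inserted edge merges two distinct classes into one: one edge more, one component
  fewer.\<close>

lemma card_edge_forest:
  assumes "edge_forest F" "\<Union>F \<subseteq> U" "finite U"
  shows "card (components F U) + card F = card U"
  using assms
proof (induction rule: edge_forest.induct)
  case empty
  have "components {} U = (\<lambda>u. {u}) ` U" by (auto simp: components_def joined_def)
  then show ?case by (simp add: card_image)
next
  case (insert F u v)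
  let ?u = "joined F `` {u}" and ?v = "joined F `` {v}"
  have nin: "{u, v} \<notin> F" using insert.hyps(2) by (auto dest: joined_edge)
  have uvU: "u \<in> U" "v \<in> U" using insert.prems by auto
  have neq: "?u \<noteq> ?v" using insert.hyps(2) by (simp add: joined_class_eq_iff)
  have eq: "components (insert {u, v} F) U = insert (?u \<union> ?v) (components F U - {?u, ?v})"
  proof (intro equalityI subsetI)
    fix X assume "X \<in> components (insert {u, v} F) U"
    then obtain x where x: "x \<in> U" "X = joined (insert {u, v} F) `` {x}"
      by (auto simp: components_def)
    show "X \<in> insert (?u \<union> ?v) (components F U - {?u, ?v})"
    proof (cases "(x, u) \<in> joined F \<or> (x, v) \<in> joined F")
      case True then show ?thesis using x(2) unfolding joined_insert_class by auto
    next
      case False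
      then have "X = joined F `` {x}" using x(2) unfolding joined_insert_class by auto
      moreover have "joined F `` {x} \<noteq> ?u" "joined F `` {x} \<noteq> ?v"
        using False by (simp_all only: joined_class_eq_iff) auto
      ultimately show ?thesis using x(1) by (auto simp: components_def)
    qed
  next
    fix X assume X: "X \<in> insert (?u \<union> ?v) (components F U - {?u, ?v})"
    show "X \<in> components (insert {u, v} F) U"
    proof (cases "X = ?u \<union> ?v")
      case True
      then have "X = joined (insert {u, v} F) `` {u}" unfolding joined_insert_class by simp
      then show ?thesis using uvU by (auto simp: components_def)
    next
      case False
      then obtain x where x: "x \<in> U" "X = joined F `` {x}" "X \<noteq> ?u" "X \<noteq> ?v"
        using X by (auto simp: components_def)
      then have "X = joined (insert {u, v} F) `` {x}"
        unfolding joined_insert_class using joined_class_eq_iff by metis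
      then show ?thesis using x by (auto simp: components_def)
    qed
  qed
  have fin: "finite (components F U)" using insert.prems by (simp add: components_def)
  \<comment> \<open>The merged class must be new, otherwise inserting it would not raise the
    cardinality by one.\<close>
  have "?u \<union> ?v \<notin> components F U"
  proof
    assume "?u \<union> ?v \<in> components F U"
    then obtain x where "?u \<union> ?v = joined F `` {x}" by (auto simp: components_def)
    then have "(x, u) \<in> joined F" "(x, v) \<in> joined F" by blast+
    then show False using insert.hyps(2) by (meson joined_sym joined_trans)
  qed
  moreover have "{?u, ?v} \<subseteq> components F U" using uvU by (auto simp: components_def)
  moreover have "card {?u, ?v} = 2" using neq by simp
  ultimately have "card (components (insert {u, v} F) U) = card (components F U) - 2 + 1"
    unfolding eq using fin by (simp add: card_Diff_subset)
  moreover have "2 \<le> card (components F U)"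
    using \<open>card {?u, ?v} = 2\<close> \<open>{?u, ?v} \<subseteq> components F U\<close> fin by (metis card_mono)
  moreover have "card (components F U) + card F = card U" using insert by simp
  moreover have "finite F" using insert.hyps(1) by (rule finite_edge_forest)
  ultimately show ?case using nin by simp
qed

text \<open>Take a maximal forest between \<open>F\<close> and \<open>A\<close>: an edge of
  \<open>A\<close> whose ends it does not join could still be added.\<close>

lemma edge_forest_extend:
  assumes "edge_forest F" "F \<subseteq> A" "finite A"
  shows "\<exists>F'. edge_forest F' \<and> F \<subseteq> F' \<and> F' \<subseteq> A \<and> joined F' = joined A"
proof -
  let ?P = "\<lambda>F'. edge_forest F' \<and> F \<subseteq> F' \<and> F' \<subseteq> A"
  have "finite {F'. ?P F'}" by (rule finite_subset[of _ "Pow A"]) (use assms in auto)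
  moreover have "{F'. ?P F'} \<noteq> {}" using assms by blast
  ultimately have "\<exists>M\<in>{F'. ?P F'}. \<forall>F'\<in>{F'. ?P F'}. M \<subseteq> F' \<longrightarrow> M = F'"
    by (rule finite_has_maximal)
  then obtain M where "M \<in> {F'. ?P F'}" and "\<forall>F'\<in>{F'. ?P F'}. M \<subseteq> F' \<longrightarrow> M = F'" ..
  then have M: "?P M" "\<And>F'. ?P F' \<Longrightarrow> M \<subseteq> F' \<Longrightarrow> M = F'" by simp_all
  have "(u, v) \<in> joined M" if "{u, v} \<in> A" for u v
  proof (rule ccontr)
    assume n: "(u, v) \<notin> joined M"
    then have "?P (insert {u, v} M)" using M(1) that by (auto intro: edge_forest.insert)
    then have "{u, v} \<in> M" using M(2) by blast
    then show False using n by (auto dest: joined_edge)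
  qed
  then have "joined A \<subseteq> joined M" by (rule joined_subset)
  moreover have "joined M \<subseteq> joined A" using M(1) by (simp add: joined_mono)
  ultimately show ?thesis using M(1) by blast
qed

subsection \<open>A spanning forest of small weighted degree\<close>

text \<open>
  The vertices are added in the order of increasing \<open>l\<close>, and \<open>a\<close> is the current level.
  A vertex \<open>v\<close> outside \<open>U\<close> that already has a neighbour in \<open>U\<close> will be attached to the cheapest
  one, which saves \<open>a - l u\<close> against the budget \<open>2 * a\<close> of \<open>v\<close>; the last sum books these savings in
  advance (its terms vanish for \<open>v\<close> without neighbours in \<open>U\<close>).  Raising \<open>a\<close> by \<open>\<delta>\<close> changes the
  right side by \<open>\<delta>\<close> times the size of the boundary of \<open>U\<close> and the left side by
  \<open>\<delta> * (2 * c - 1)\<close> with \<open>c = card U - card F\<close> components, so \<open>expand\<close> keeps the inequality; adding a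
  vertex at level \<open>a = l v\<close> changes both sides equally if all further edges cost \<open>2 * a\<close>.
\<close>

lemma light_forest:
  fixes l :: "'a \<Rightarrow> real"
  assumes V: "finite V" and A: "\<And>e. e \<in> A \<Longrightarrow> \<exists>u\<in>V. \<exists>v\<in>V. u \<noteq> v \<and> e = {u, v}"
    and l: "\<And>v. v \<in> V \<Longrightarrow> 0 \<le> l v"
    and expand: "\<And>U. U \<subset> V \<Longrightarrow> U \<noteq> {} \<Longrightarrow>
      2 * card (components {e \<in> A. e \<subseteq> U} U) \<le> card {v \<in> V - U. \<exists>u\<in>U. {u, v} \<in> A} + 1"
    and "U \<subseteq> V" "0 \<le> a" "\<And>u. u \<in> U \<Longrightarrow> l u \<le> a" "\<And>v. v \<in> V - U \<Longrightarrow> a \<le> l v"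
    and "U = V \<Longrightarrow> a \<in> l ` V"
  shows "\<exists>F. edge_forest F \<and> F \<subseteq> {e \<in> A. e \<subseteq> U} \<and> joined F = joined {e \<in> A. e \<subseteq> U} \<and>
    2 * a * (real (card U) - real (card F)) - a \<le>
      2 * sum l U - (\<Sum>e\<in>F. sum l e) +
      (\<Sum>v\<in>V - U. a - Min (insert a (l ` {u \<in> U. {u, v} \<in> A})))"
  using assms(5-)
proof (induction "card U" arbitrary: U a rule: less_induct)
  case less
  have finU: "finite U" using less.prems V finite_subset by blast
  have "A \<subseteq> Pow V" using A by blast
  then have finA: "finite A" using V finite_subset by blast
  show ?case
  \<comment> \<open>Without vertices there is no saving, as \<open>Min (insert a {}) = a\<close>,
    and the claim reduces to \<open>- a \<le> 0\<close>.\<close>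
  proof (cases "U = {}")
    case True
    have none: "{e \<in> A. e \<subseteq> U} = {}" using A True by fastforce
    show ?thesis unfolding none
      using True less.prems(2) edge_forest.empty by (intro exI[of _ "{}"]) simp
  next
    case False
    \<comment> \<open>\<open>x\<close> is the vertex of \<open>U\<close> added last. The induction
      hypothesis is used for the earlier vertices \<open>W\<close> at the level
      \<open>b = l x\<close>.\<close>
    then obtain x where x: "x \<in> U" "\<And>u. u \<in> U \<Longrightarrow> l u \<le> l x"
      using finU finite_imageI[OF finU, of l] Max_in[of "l ` U"] Max_ge[of "l ` U"]
      by (metis (no_types, lifting) image_iff image_is_empty imageI)
    define b where "b = l x"
    define W where "W = U - {x}"
    have UW: "U = insert x W" "x \<notin> W" "W \<subset> V" "finite W" "x \<in> V"
      using x less.prems finU by (auto simp: W_def)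
    have b0: "0 \<le> b" using l UW b_def by auto
    have ba: "b \<le> a" using less.prems x by (auto simp: b_def)
    have "\<exists>F. edge_forest F \<and> F \<subseteq> {e \<in> A. e \<subseteq> W} \<and> joined F = joined {e \<in> A. e \<subseteq> W} \<and>
      2 * b * (real (card W) - real (card F)) - b \<le>
      2 * sum l W - (\<Sum>e\<in>F. sum l e) +
      (\<Sum>v\<in>V - W. b - Min (insert b (l ` {u \<in> W. {u, v} \<in> A})))"
    proof (rule less.hyps)
      show "card W < card U" using UW by simp
      show "b \<le> l v" if "v \<in> V - W" for v
      proof (cases "v = x")
        case False
        with that have "a \<le> l v" using less.prems(4)[of v] UW(1) by auto
        then show ?thesis using ba by simp
      qed (simp add: b_def)
      show "l u \<le> b" if "u \<in> W" for u using that x(2) by (simp add: W_def b_def)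
      show "W \<subseteq> V" "0 \<le> b" "b \<in> l ` V" using UW(3) b0 imageI[OF UW(5), of l] unfolding b_def by simp_all
    qed
    then obtain F where F: "edge_forest F" "F \<subseteq> {e \<in> A. e \<subseteq> W}"
      "joined F = joined {e \<in> A. e \<subseteq> W}"
      and Fle: "2 * b * (real (card W) - real (card F)) - b \<le>
        2 * sum l W - (\<Sum>e\<in>F. sum l e) +
        (\<Sum>v\<in>V - W. b - Min (insert b (l ` {u \<in> W. {u, v} \<in> A})))"
      by - (elim exE conjE, rule that)
    have finF: "finite F" using F(1) by (rule finite_edge_forest)
    let ?N = "{u \<in> W. {u, x} \<in> A}"
    let ?m = "Min (insert b (l ` ?N))"
    \<comment> \<open>The edge from \<open>x\<close> to its cheapest neighbour in \<open>W\<close>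
      costs \<open>b + ?m\<close>, which is \<open>2 * b\<close> less the saving
      \<open>b - ?m\<close>. Any other new edge costs at most \<open>2 * b\<close>.\<close>
    have step: "\<exists>F'. edge_forest F' \<and> F' \<subseteq> {e \<in> A. e \<subseteq> U} \<and> joined F' = joined {e \<in> A. e \<subseteq> U} \<and>
      (\<Sum>e\<in>F'. sum l e) \<le> (\<Sum>e\<in>F. sum l e) + (?m - b) + 2 * b * (real (card F') - real (card F))"
    proof (cases "?N = {}")
      case True
      have "{e \<in> A. e \<subseteq> U} = {e \<in> A. e \<subseteq> W}"
      proof -
        have "x \<notin> e" if "e \<in> A" "e \<subseteq> U" for e
        proof
          assume "x \<in> e"
          then obtain y where "e = {y, x}" "y \<noteq> x" using A[OF \<open>e \<in> A\<close>] by auto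
          then have "y \<in> ?N" using \<open>e \<in> A\<close> \<open>e \<subseteq> U\<close> UW(1) by auto
          then show False using True by blast
        qed
        then show ?thesis using UW by auto
      qed
      moreover have "?m = b" unfolding True by simp
      ultimately show ?thesis using F by (intro exI[of _ F]) simp
    next
      case False
      have finN: "finite (l ` ?N)" using UW by simp
      have "Min (l ` ?N) \<in> l ` ?N" using False finN by (intro Min_in) auto
      then obtain u where u: "u \<in> ?N" "l u = Min (l ` ?N)" by auto
      have "l u \<le> b" using u(1) x(2)[of u] UW(1) by (simp add: b_def)
      then have m: "?m = l u" using u finN False by (simp add: Min_insert)
      \<comment> \<open>All edges of \<open>F\<close> lie inside \<open>W\<close>, so
        \<open>{x}\<close> is closed under them.\<close>
      have "(x, u) \<notin> joined F"
      proof
        assume "(x, u) \<in> joined F"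
        then have "u \<in> {x}" by (rule joined_closed) (use F UW in auto)
        then show False using u UW by auto
      qed
      then have "edge_forest (insert {x, u} F)" using F by (intro edge_forest.insert)
      moreover have "insert {x, u} F \<subseteq> {e \<in> A. e \<subseteq> U}"
        using u UW F by (auto simp: insert_commute)
      moreover have "finite {e \<in> A. e \<subseteq> U}" using finA by simp
      ultimately have "\<exists>F'. edge_forest F' \<and> insert {x, u} F \<subseteq> F' \<and> F' \<subseteq> {e \<in> A. e \<subseteq> U} \<and>
          joined F' = joined {e \<in> A. e \<subseteq> U}" by (rule edge_forest_extend)
      then obtain F' where F': "edge_forest F'" "insert {x, u} F \<subseteq> F'"
        "F' \<subseteq> {e \<in> A. e \<subseteq> U}" "joined F' = joined {e \<in> A. e \<subseteq> U}"
        by - (elim exE conjE, rule that)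
      have finF': "finite F'" using F'(1) by (rule finite_edge_forest)
      have nin: "{x, u} \<notin> F" using F(2) UW(2) by blast
      have xu: "x \<noteq> u" using u(1) UW(2) by blast
      let ?R = "F' - insert {x, u} F"
      have "sum l e \<le> 2 * b" if "e \<in> ?R" for e
      proof -
        have "e \<in> A" "e \<subseteq> U" using that F' by auto
        then obtain p q where "e = {p, q}" "p \<noteq> q" "p \<in> U" "q \<in> U" using A by blast
        then show ?thesis using x(2)[of p] x(2)[of q] by (simp add: b_def)
      qed
      then have "(\<Sum>e\<in>?R. sum l e) \<le> of_nat (card ?R) * (2 * b)" by (rule sum_bounded_above)
      moreover have "card ?R = card F' - (card F + 1)"
        using nin finF F' by (simp add: card_Diff_subset)
      moreover have "card F + 1 \<le> card F'"
        using card_mono[OF finF' F'(2)] nin finF by simp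
      moreover have "(\<Sum>e\<in>F'. sum l e) = (\<Sum>e\<in>?R. sum l e) + (\<Sum>e\<in>insert {x, u} F. sum l e)"
        using sum.subset_diff[OF F'(2) finF'] .
      moreover have "(\<Sum>e\<in>insert {x, u} F. sum l e) = b + l u + (\<Sum>e\<in>F. sum l e)"
        using nin finF xu by (simp add: b_def)
      ultimately have "(\<Sum>e\<in>F'. sum l e) \<le>
          (\<Sum>e\<in>F. sum l e) + (l u - b) + 2 * b * (real (card F') - real (card F))"
        by (simp add: of_nat_diff algebra_simps)
      then show ?thesis using F' m by auto
    qed
    then obtain F' where F': "edge_forest F'" "F' \<subseteq> {e \<in> A. e \<subseteq> U}"
      "joined F' = joined {e \<in> A. e \<subseteq> U}"
      and F'le: "(\<Sum>e\<in>F'. sum l e) \<le>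
        (\<Sum>e\<in>F. sum l e) + (?m - b) + 2 * b * (real (card F') - real (card F))"
      by - (elim exE conjE, rule that)
    let ?g = "\<lambda>a v. a - Min (insert a (l ` {u \<in> U. {u, v} \<in> A}))"
    \<comment> \<open>When \<open>x\<close> enters \<open>U\<close>, the saving booked for it leaves
      the sum; it pays for the term \<open>?m - b\<close> in \<open>step\<close>.\<close>
    have "(\<Sum>v\<in>V - W. b - Min (insert b (l ` {u \<in> W. {u, v} \<in> A}))) =
        b - ?m + (\<Sum>v\<in>V - U. b - Min (insert b (l ` {u \<in> W. {u, v} \<in> A})))"
    proof -
      have "V - W = insert x (V - U)" using UW(1,2,5) by blast
      moreover have "finite (V - U)" "x \<notin> V - U" using V x(1) by auto
      ultimately show ?thesis by simp
    qed
    \<comment> \<open>A new neighbour \<open>x\<close> contributes the value \<open>l x = b\<close>,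
      which is already among those minimised.\<close>
    also have "(\<Sum>v\<in>V - U. b - Min (insert b (l ` {u \<in> W. {u, v} \<in> A}))) = (\<Sum>v\<in>V - U. ?g b v)"
    proof (rule sum.cong)
      fix v
      have "insert b (l ` {u \<in> U. {u, v} \<in> A}) = insert b (l ` {u \<in> W. {u, v} \<in> A})"
        using UW(1) by (auto simp: b_def)
      then show "b - Min (insert b (l ` {u \<in> W. {u, v} \<in> A})) = ?g b v" by simp
    qed simp
    finally have at_b: "2 * b * (real (card U) - real (card F')) - b \<le>
        2 * sum l U - (\<Sum>e\<in>F'. sum l e) + (\<Sum>v\<in>V - U. ?g b v)"
      using Fle F'le UW by (simp add: b_def algebra_simps)
    have "2 * a * (real (card U) - real (card F')) - a \<le>
        2 * sum l U - (\<Sum>e\<in>F'. sum l e) + (\<Sum>v\<in>V - U. ?g a v)"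
    \<comment> \<open>The level is now raised from \<open>b\<close> to \<open>a\<close>. For
      \<open>U = V\<close> there is no boundary to pay for this, but then \<open>a\<close> is a
      value of \<open>l\<close> and equals \<open>b\<close>.\<close>
    proof (cases "U = V")
      case True
      then obtain y where "y \<in> U" "a = l y" using less.prems(5) by blast
      then have "a = b" using x(2)[of y] ba by (simp add: b_def)
      then show ?thesis using at_b by simp
    next
      case False
      let ?B = "{v \<in> V - U. \<exists>u\<in>U. {u, v} \<in> A}"
      \<comment> \<open>A boundary vertex has a neighbour of value at most \<open>b\<close>, so its
        minimum stays fixed while the level rises. For any other vertex the minimum is the level
        itself.\<close>
      have "?g b v + (if v \<in> ?B then a - b else 0) = ?g a v" if "v \<in> V - U" for v
      proof (cases "v \<in> ?B")
        case True
        let ?L = "l ` {u \<in> U. {u, v} \<in> A}"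
        have L: "finite ?L" "?L \<noteq> {}" using finU True by auto
        have "Min ?L \<in> ?L" using L by (rule Min_in)
        then obtain u where "u \<in> U" "Min ?L = l u" by blast
        then have "Min ?L \<le> b" using x(2) by (simp add: b_def)
        then have "Min (insert a ?L) = Min ?L" "Min (insert b ?L) = Min ?L"
          using L ba by (simp_all add: Min_insert)
        then show ?thesis using True by simp
      next
        case False
        then have "{u \<in> U. {u, v} \<in> A} = {}" using that by auto
        then show ?thesis using False by (simp only:) simp
      qed
      then have "(\<Sum>v\<in>V - U. ?g a v) = (\<Sum>v\<in>V - U. ?g b v + (if v \<in> ?B then a - b else 0))"
        by (intro sum.cong) auto
      also have "\<dots> = (\<Sum>v\<in>V - U. ?g b v) + (a - b) * card ?B"
        using V by (simp add: sum.distrib sum.If_cases Int_def conj_commute)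
      finally have g: "(\<Sum>v\<in>V - U. ?g a v) = (\<Sum>v\<in>V - U. ?g b v) + (a - b) * card ?B" .
      have "components F' U = components {e \<in> A. e \<subseteq> U} U" using F' by (simp add: components_def)
      moreover have "card (components F' U) + card F' = card U"
        using F' finU by (intro card_edge_forest) auto
      moreover have "2 * card (components {e \<in> A. e \<subseteq> U} U) \<le> card ?B + 1"
        using False less.prems(1) \<open>U \<noteq> {}\<close> by (intro expand) auto
      ultimately have "2 * card U \<le> card ?B + 1 + 2 * card F'" by simp
      then have "real (2 * card U) \<le> real (card ?B + 1 + 2 * card F')" by (simp only: of_nat_le_iff)
      then have "2 * (real (card U) - real (card F')) - 1 \<le> real (card ?B)" by simp
      then have "(a - b) * (2 * (real (card U) - real (card F')) - 1) \<le> (a - b) * real (card ?B)"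
        using ba by (intro mult_left_mono) auto
      then show ?thesis using at_b g by (simp add: algebra_simps)
    qed
    then show ?thesis using F' by blast
  qed
qed

subsection \<open>Minimising the partition function\<close>

text \<open>Pinning the coordinates outside \<open>V\<close> to 0 makes the box a product of compact
  sets over the whole type, so it is compact in the function space by Tychonoff's theorem.\<close>

lemma continuous_attains_inf_box:
  fixes \<Phi> :: "('a \<Rightarrow> real) \<Rightarrow> real"
  assumes "continuous_on UNIV \<Phi>" "0 \<le> B"
  shows "\<exists>l. (\<forall>v\<in>V. 0 \<le> l v \<and> l v \<le> B) \<and>
    (\<forall>m. (\<forall>v\<in>V. 0 \<le> m v \<and> m v \<le> B) \<and> (\<forall>v. v \<notin> V \<longrightarrow> m v = 0) \<longrightarrow> \<Phi> l \<le> \<Phi> m) \<and>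
    (\<forall>v. v \<notin> V \<longrightarrow> l v = 0)"
proof -
  let ?S = "PiE UNIV (\<lambda>v. if v \<in> V then {0..B} else {0})"
  have "compactin (product_topology (\<lambda>_. euclidean) UNIV) ?S"
    by (subst compactin_PiE) auto
  then have "compact ?S" by (simp add: euclidean_product_topology)
  moreover have "(\<lambda>_. 0) \<in> ?S" using assms by auto
  ultimately obtain l where l: "l \<in> ?S" "\<And>m. m \<in> ?S \<Longrightarrow> \<Phi> l \<le> \<Phi> m"
    using continuous_attains_inf[of ?S \<Phi>] continuous_on_subset[OF assms(1)] by blast
  have S: "m \<in> ?S \<longleftrightarrow> (\<forall>v\<in>V. 0 \<le> m v \<and> m v \<le> B) \<and> (\<forall>v. v \<notin> V \<longrightarrow> m v = 0)" for m
    by (auto simp: PiE_iff split: if_splits)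
  from l show ?thesis unfolding S by blast
qed

text \<open>Trees enter only through abstract degrees \<open>d\<close>. At a minimum of \<Psi> l -
  \<epsilon> * (\<Sum>v. l v) on a large box, every coordinate can still be increased, so its right
  derivative is nonnegative; this bounds the weighted mean of \<open>d T v\<close> by 2 -
  \<epsilon>.\<close>

lemma exp_weights_mean_less_2:
  fixes d :: "'t \<Rightarrow> 'a \<Rightarrow> real"
  assumes V: "finite V" and N: "finite N"
    and cheap: "\<And>l. (\<And>v. v \<in> V \<Longrightarrow> 0 \<le> l v) \<Longrightarrow>
      \<exists>T\<in>N. \<forall>w\<in>V. l w \<le> (\<Sum>v\<in>V. l v * (2 - d T v))"
  shows "\<exists>l. \<forall>v\<in>V. (\<Sum>T\<in>N. exp (- (\<Sum>u\<in>V. l u * d T u)) * d T v) <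
    2 * (\<Sum>T\<in>N. exp (- (\<Sum>u\<in>V. l u * d T u)))"
proof (cases "V = {}")
  case False
  define n where "n = real (card V)"
  have n: "n > 0" using False V by (simp add: n_def card_gt_0_iff)
  \<comment> \<open>With this value the penalty \<epsilon> * (\<Sum>v. l v) is at most half of the
    largest \<open>l v\<close>, that is, half of the growth provided by
    \<open>cheap\<close>.\<close>
  define \<epsilon> where "\<epsilon> = 1 / (2 * n)"
  have \<epsilon>: "\<epsilon> > 0" using n by (simp add: \<epsilon>_def)
  have Nne: "N \<noteq> {}" using cheap[of "\<lambda>_. 0"] by auto
  define Z where "Z l = (\<Sum>T\<in>N. exp (- (\<Sum>u\<in>V. l u * d T u)))" for l
  \<comment> \<open>The factor \<open>exp (2 * sum l V)\<close> of the partition function is pulled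
    out of the logarithm.\<close>
  define \<Phi> where "\<Phi> l = ln (Z l) + (2 - \<epsilon>) * (\<Sum>v\<in>V. l v)" for l
  have Zpos: "Z l > 0" for l unfolding Z_def using N Nne by (intro sum_pos) auto
  have "continuous_on UNIV (\<lambda>l. l v :: real)" for v :: 'a
    by (rule continuous_on_product_coordinates)
  then have contZ: "continuous_on UNIV Z"
    unfolding Z_def by (intro continuous_intros)
  have cont: "continuous_on UNIV \<Phi>"
    unfolding \<Phi>_def using contZ Zpos
    by (intro continuous_intros continuous_on_product_coordinates) (auto simp: less_imp_neq[symmetric])
  \<comment> \<open>Comparison with the zero function gives \<open>l x / 2 \<le> ln (card N)\<close>
    for the largest value \<open>l x\<close>; adding 1 makes the bound strict.\<close>
  define B where "B = 2 * ln (real (card N)) + 1"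
  have cardN: "real (card N) \<ge> 1" using N Nne by (simp add: Suc_le_eq card_gt_0_iff)
  have B: "B > 0" using cardN by (simp add: B_def add_nonneg_pos)
  obtain l where l: "\<forall>v\<in>V. 0 \<le> l v \<and> l v \<le> B" "\<forall>v. v \<notin> V \<longrightarrow> l v = 0"
    and min: "\<And>m. (\<forall>v\<in>V. 0 \<le> m v \<and> m v \<le> B) \<Longrightarrow> (\<forall>v. v \<notin> V \<longrightarrow> m v = 0) \<Longrightarrow> \<Phi> l \<le> \<Phi> m"
    using continuous_attains_inf_box[OF cont, of B V] B by force
  have interior: "l w < B" if "w \<in> V" for w
  proof -
    have "Max (l ` V) \<in> l ` V" using V False by (intro Max_in) auto
    then obtain x where x: "x \<in> V" "l x = Max (l ` V)" by auto
    have le: "l v \<le> l x" if "v \<in> V" for v using x V that by simp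
    obtain T where T: "T \<in> N" "l x \<le> (\<Sum>v\<in>V. l v * (2 - d T v))"
      using cheap[of l] l x by blast
    have "exp (- (\<Sum>u\<in>V. l u * d T u)) \<le> Z l"
      unfolding Z_def using N T by (intro member_le_sum) auto
    then have "- (\<Sum>u\<in>V. l u * d T u) \<le> ln (Z l)" using Zpos by (simp add: ln_ge_iff)
    then have "l x - \<epsilon> * (\<Sum>v\<in>V. l v) \<le> \<Phi> l"
      using T unfolding \<Phi>_def by (simp add: algebra_simps sum_subtractf sum_distrib_left sum_distrib_right)
    moreover have "(\<Sum>v\<in>V. l v) \<le> n * l x" unfolding n_def using le by (rule sum_bounded_above)
    then have "\<epsilon> * (\<Sum>v\<in>V. l v) \<le> \<epsilon> * (n * l x)" using \<epsilon> by (intro mult_left_mono) auto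
    moreover have "\<epsilon> * (n * l x) = l x / 2" using n by (simp add: \<epsilon>_def)
    moreover have "\<Phi> l \<le> \<Phi> (\<lambda>_. 0)" using B by (intro min) auto
    moreover have "\<Phi> (\<lambda>_. 0) = ln (real (card N))" by (simp add: \<Phi>_def Z_def)
    ultimately have "l x < B" unfolding B_def by linarith
    then show ?thesis using le[OF that] by linarith
  qed
  have "(\<Sum>T\<in>N. exp (- (\<Sum>u\<in>V. l u * d T u)) * d T v) < 2 * Z l" if v: "v \<in> V" for v
  proof (rule ccontr)
    assume large: "\<not> ?thesis"
    define D where "D = (\<Sum>T\<in>N. exp (- (\<Sum>u\<in>V. l u * d T u)) * d T v)"
    have "D \<ge> 2 * Z l" using large by (simp add: D_def)
    define h where "h t = ln (\<Sum>T\<in>N. exp (- ((\<Sum>u\<in>V. l u * d T u) + t * d T v))) +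
      (2 - \<epsilon>) * ((\<Sum>u\<in>V. l u) + t)" for t
    have upd: "(\<Sum>u\<in>V. (l(v := l v + t)) u * c u) = (\<Sum>u\<in>V. l u * c u) + t * c v"
      for t and c :: "'a \<Rightarrow> real"
    proof -
      have "(\<Sum>u\<in>V. (l(v := l v + t)) u * c u) = (\<Sum>u\<in>V. l u * c u + (if u = v then t * c u else 0))"
        by (rule sum.cong) (auto simp: algebra_simps)
      also have "\<dots> = (\<Sum>u\<in>V. l u * c u) + t * c v" using V v by (simp add: sum.distrib)
      finally show ?thesis .
    qed
    have h: "\<Phi> (l(v := l v + t)) = h t" for t
    proof -
      have "(\<Sum>u\<in>V. (l(v := l v + t)) u) = (\<Sum>u\<in>V. l u) + t"
        using upd[of t "\<lambda>_. 1"] by (simp del: fun_upd_apply)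
      then show ?thesis unfolding \<Phi>_def Z_def h_def upd by (simp only:)
    qed
    have "(h has_real_derivative (- D / Z l + (2 - \<epsilon>))) (at 0)"
    proof -
      have "((\<lambda>t. exp (- ((\<Sum>u\<in>V. l u * d T u) + t * d T v))) has_real_derivative
          - (exp (- (\<Sum>u\<in>V. l u * d T u)) * d T v)) (at 0)" for T
        by (rule derivative_eq_intros refl)+ simp
      then have "((\<lambda>t. \<Sum>T\<in>N. exp (- ((\<Sum>u\<in>V. l u * d T u) + t * d T v))) has_real_derivative - D) (at 0)"
        unfolding D_def sum_negf[symmetric] by (intro DERIV_sum)
      then have "((\<lambda>t. ln (\<Sum>T\<in>N. exp (- ((\<Sum>u\<in>V. l u * d T u) + t * d T v)))) has_real_derivative
          - D / Z l) (at 0)"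
        using Zpos[of l] by (auto intro!: derivative_eq_intros simp: Z_def D_def sum_negf)
      then show ?thesis unfolding h_def by (rule DERIV_add) (auto intro!: derivative_eq_intros)
    qed
    moreover have "- D / Z l + (2 - \<epsilon>) < 0"
      using \<open>D \<ge> 2 * Z l\<close> Zpos[of l] \<epsilon> by (simp add: field_simps) (use mult_pos_pos[OF \<epsilon> Zpos[of l]] in linarith)
    ultimately obtain \<delta> where \<delta>: "\<delta> > 0" "\<And>t. 0 < t \<Longrightarrow> t < \<delta> \<Longrightarrow> h (0 + t) < h 0"
      using DERIV_neg_dec_right[of h _ 0] by blast
    \<comment> \<open>The step is short enough for \<open>h\<close> to decrease and for the new
      point to stay in the box.\<close>
    define t where "t = min (\<delta> / 2) (B - l v)"
    have t: "0 < t" "t < \<delta>" "l v + t \<le> B" using \<delta> interior[OF v] by (auto simp: t_def)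
    have "\<Phi> l \<le> \<Phi> (l(v := l v + t))" using t l v by (intro min) auto
    moreover have "\<Phi> l = h 0" using h[of 0] by simp
    ultimately show False using h \<delta>(2)[of t] t by simp
  qed
  then show ?thesis unfolding Z_def by blast
qed simp

subsection \<open>Spanning trees and toughness\<close>

lemma spanning_subgraph_simps [simp]:
  "pverts (spanning_subgraph G F) = pverts G"
  "parcs (spanning_subgraph G F) = {(u, v). {u, v} \<in> F}"
  by (simp_all add: spanning_subgraph_def)

section \<open>Edge forests contain no undirected cycle\<close>

lemma cas_joined:
  assumes "pre_digraph.cas (with_proj H) u p v" "\<And>x y. (x, y) \<in> set p \<Longrightarrow> {x, y} \<in> F"
  shows "(u, v) \<in> joined F"
  using assms
proof (induction p arbitrary: u)
  case Nil
  then show ?case by (simp add: pre_digraph.cas.simps)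
next
  case (Cons e p)
  obtain x y where e: "e = (x, y)" by (cases e)
  have "(y, v) \<in> joined F"
    using Cons.prems by (intro Cons.IH) (auto simp: pre_digraph.cas.simps e)
  moreover have "u = x" using Cons.prems(1) by (simp add: pre_digraph.cas.simps e)
  moreover have "(x, y) \<in> joined F" using Cons.prems(2)[of x y] e by (auto intro: joined_edge)
  ultimately show ?case by (blast intro: joined_trans)
qed

lemma cas_append_iff:
  "pre_digraph.cas (with_proj H) u (p @ q) v \<longleftrightarrow>
    (\<exists>w. pre_digraph.cas (with_proj H) u p w \<and> pre_digraph.cas (with_proj H) w q v)"
  by (induction p arbitrary: u) (auto simp: pre_digraph.cas.simps)

lemma cas_snd_last:
  "pre_digraph.cas (with_proj H) u p v \<Longrightarrow> p \<noteq> [] \<Longrightarrow> v \<in> snd ` set p"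
proof (induction p arbitrary: u)
  case (Cons e p)
  then show ?case by (cases "p = []") (auto simp: pre_digraph.cas.simps)
qed simp

text \<open>\<open>cycle\<close> demands distinctness of the tail of the vertex list, which consists
  of the heads of the arcs.\<close>

lemma tl_awalk_verts:
  "pre_digraph.cas (with_proj H) u p v \<Longrightarrow> tl (pre_digraph.awalk_verts (with_proj H) w p) = map snd p"
proof (induction p arbitrary: u w)
  case (Cons e p)
  then have "pre_digraph.cas (with_proj H) (snd e) p v" by (simp add: pre_digraph.cas.simps)
  then have IH: "tl (pre_digraph.awalk_verts (with_proj H) (snd e) p) = map snd p" by (rule Cons.IH)
  have "hd (pre_digraph.awalk_verts (with_proj H) (snd e) p) = snd e"
    using \<open>pre_digraph.cas (with_proj H) (snd e) p v\<close>
    by (cases p) (simp_all add: pre_digraph.cas.simps pre_digraph.awalk_verts.simps)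
  moreover have "pre_digraph.awalk_verts (with_proj H) (snd e) p \<noteq> []"
    by (cases p) (simp_all add: pre_digraph.awalk_verts.simps)
  ultimately show ?case
    using IH by (simp add: pre_digraph.awalk_verts.simps) (metis list.collapse)
qed (simp add: pre_digraph.awalk_verts.simps)

text \<open>Cutting the newest edge out of a cycle leaves a walk in the older edges between its
  ends, which were not joined before.\<close>

lemma undirected_acyclic_edge_forest:
  assumes "edge_forest F"
  shows "undirected_acyclic (spanning_subgraph G F)"
  using assms
proof (induction rule: edge_forest.induct)
  case empty
  show ?case
    by (auto simp: undirected_acyclic_def pre_digraph.cycle_def pre_digraph.awalk_def)
next
  case (insert F a b)
  let ?H = "with_proj (spanning_subgraph G F)"
  let ?H' = "with_proj (spanning_subgraph G (insert {a, b} F))"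
  show ?case unfolding undirected_acyclic_def
  proof
    assume "\<exists>p. pre_digraph.cycle ?H' p \<and> 3 \<le> length p"
    then obtain p u where p: "u \<in> pverts G" "set p \<subseteq> {(x, y). {x, y} \<in> insert {a, b} F}"
      "pre_digraph.cas ?H' u p u" "distinct (map snd p)" "3 \<le> length p"
      by (auto simp: pre_digraph.cycle_def pre_digraph.awalk_def tl_awalk_verts)
    show False
    proof (cases "\<exists>x y. (x, y) \<in> set p \<and> {x, y} = {a, b}")
      case False
      then have "set p \<subseteq> {(x, y). {x, y} \<in> F}" using p(2) by blast
      moreover have "pre_digraph.cas ?H u p u" using p(3) by (simp add: cas_with_proj_eq)
      ultimately have "pre_digraph.cycle ?H p"
        using p by (auto simp: pre_digraph.cycle_def pre_digraph.awalk_def tl_awalk_verts)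
      then show False using insert.IH p(5) by (auto simp: undirected_acyclic_def)
    next
      case True
      then obtain s t where st: "(s, t) \<in> set p" "{s, t} = {a, b}" by blast
      then obtain q r where qr: "p = q @ (s, t) # r" by (meson split_list)
      have sub: "{x, y} = {s, t} \<or> {x, y} \<in> F" if "(x, y) \<in> set (r @ q)" for x y
        using that p(2) st(2) by (auto simp: qr)
      have walk: "pre_digraph.cas ?H' t (r @ q) s"
        using p(3) unfolding qr cas_append_iff by (auto simp: pre_digraph.cas.simps)
      have dist: "distinct (map snd (r @ q))" "t \<notin> snd ` set (r @ q)"
        using p(4) by (auto simp: qr)
      \<comment> \<open>The remaining walk might use the new edge backwards. Distinct heads then
        leave no room for further arcs, so the cycle has length 2, which the bound 3
        excludes.\<close>
      have "{x, y} \<in> F" if xy: "(x, y) \<in> set (r @ q)" for x y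
      proof (rule ccontr)
        assume "{x, y} \<notin> F"
        then have "{x, y} = {s, t}" using sub[OF xy] by blast
        moreover have "y \<noteq> t" using dist(2) xy by force
        ultimately have ts: "x = t" "y = s" by (auto simp: doubleton_eq_iff)
        obtain q1 q2 where q12: "r @ q = q1 @ (t, s) # q2" using xy ts by (meson split_list)
        have walks: "pre_digraph.cas ?H' t q1 t" "pre_digraph.cas ?H' s q2 s"
          using walk unfolding q12 cas_append_iff by (auto simp: pre_digraph.cas.simps)
        have "t \<notin> snd ` set q1" "s \<notin> snd ` set q2"
          using dist unfolding q12 by auto
        then have "q1 = []" "q2 = []" using walks cas_snd_last by metis+
        then have "length (r @ q) = 1" using q12 by simp
        then show False using p(5) qr by simp
      qed
      with walk have "(t, s) \<in> joined F" by (rule cas_joined)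
      moreover have "(s = a \<and> t = b) \<or> (s = b \<and> t = a)" using st(2) by (auto simp: doubleton_eq_iff)
      ultimately show False using insert.hyps(2) by (auto intro: joined_sym)
    qed
  qed
qed

section \<open>Connectedness and spanning trees in terms of joined vertices\<close>

text \<open>\<open>connected\<close> means strong connectedness of the symmetric closure. For
  symmetric arcs that closure adds no reachability. Assuming only a symmetric arc set within the
  vertices makes this apply to \<open>G\<close> and to its spanning subgraphs.\<close>

lemma connected_iff_joined:
  assumes "sym (parcs H)" "parcs H \<subseteq> pverts H \<times> pverts H"
  shows "Digraph_Component.connected (with_proj H) \<longleftrightarrow>
    pverts H \<noteq> {} \<and> (\<forall>u\<in>pverts H. \<forall>v\<in>pverts H. (u, v) \<in> joined (uedges H))"
proof -
  interpret pair_wf_digraph H using assms(2) by unfold_locales auto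
  have sym: "symmetric (with_proj H)" using assms(1) by (simp add: symmetric_def)
  have arcs: "(x, y) \<in> parcs H \<longleftrightarrow> {x, y} \<in> uedges H" for x y
    using assms(1) by (auto simp: uedges_def doubleton_eq_iff sym_def)
  have "{(u, v). {u, v} \<in> uedges H} = parcs H" using arcs by auto
  then have "joined (uedges H) = (parcs H)\<^sup>*" by (simp add: joined_def)
  then show ?thesis
    unfolding Digraph_Component.connected_def strongly_connected_def
    by (auto simp: reachable_mk_symmetric_eq[OF sym] reachable_conv)
qed

context pair_graph
begin

lemma uedge_iff: "{u, v} \<in> uedges G \<longleftrightarrow> (u, v) \<in> parcs G"
  using arcs_symmetric by (auto simp: uedges_def doubleton_eq_iff)

lemma uedgesE:
  assumes "e \<in> uedges G"
  shows "\<exists>u\<in>pverts G. \<exists>v\<in>pverts G. u \<noteq> v \<and> e = {u, v}"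
proof -
  from assms obtain u v where "e = {u, v}" "(u, v) \<in> parcs G" by (auto simp: uedges_def)
  then show ?thesis
    using arc_fst_in_verts[of "(u, v)"] arc_snd_in_verts[of "(u, v)"] pair_no_loops[of "(u, v)"]
    by auto
qed

lemma uedge_verts: "{u, v} \<in> uedges G \<Longrightarrow> u \<in> pverts G \<and> v \<in> pverts G"
  using arc_fst_in_verts[of "(u, v)"] arc_snd_in_verts[of "(u, v)"] by (simp add: uedge_iff)

lemma connected_joined:
  assumes "Digraph_Component.connected (with_proj G)" "u \<in> pverts G" "v \<in> pverts G"
  shows "(u, v) \<in> joined (uedges G)"
proof -
  have "sym (parcs G)" using arcs_symmetric by (auto intro: symI)
  moreover have "parcs G \<subseteq> pverts G \<times> pverts G"
    using arc_fst_in_verts arc_snd_in_verts by force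
  ultimately show ?thesis using assms connected_iff_joined by blast
qed

lemma spanning_treeI:
  assumes con: "Digraph_Component.connected (with_proj G)"
    and F: "edge_forest F" "F \<subseteq> uedges G" "joined F = joined (uedges G)"
  shows "F \<in> spanning_trees G"
proof -
  let ?H = "spanning_subgraph G F"
  have "sym (parcs ?H)" by (auto intro: symI simp: insert_commute)
  moreover have "parcs ?H \<subseteq> pverts ?H \<times> pverts ?H"
    using F(2) uedge_iff arc_fst_in_verts arc_snd_in_verts by force
  moreover have "uedges ?H = F"
  proof -
    have "uedges ?H = {e \<in> F. \<exists>u v. e = {u, v}}" by (auto simp: uedges_def)
    moreover have "\<exists>u v. e = {u, v}" if "e \<in> F" for e using uedgesE[of e] that F(2) by auto
    ultimately show ?thesis by auto
  qed
  moreover have "pverts G \<noteq> {}"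
    using con unfolding Digraph_Component.connected_def strongly_connected_def by simp
  ultimately have "Digraph_Component.connected (with_proj ?H)"
    using con connected_joined F(3) by (simp add: connected_iff_joined)
  then show ?thesis
    using F by (simp add: spanning_trees_def undirected_acyclic_edge_forest)
qed

section \<open>From toughness to boundary expansion\<close>

text \<open>The infinite toughness of complete graphs has to be ruled out first: deleting vertices
  from one never leaves more than one component. The bound is then membership in the set of
  ratios.\<close>

lemma tough_num_components:
  assumes "tough t G" "S \<subseteq> pverts G" "1 < num_components (del_verts G S)"
  shows "t * real (num_components (del_verts G S)) \<le> real (card S)"
proof -
  have fin: "finite (pverts G)" by (rule pair_finite_verts)
  have "\<not> complete_graph G"
  proof
    assume "complete_graph G"
    then have arcs: "parcs G = {(u, v). (u, v) \<in> pverts G \<times> pverts G \<and> u \<noteq> v}"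
      by (simp add: complete_graph_def complete_digraph_pair_def)
    interpret D: wf_digraph "del_verts G S" unfolding del_verts_def by (rule wellformed_induce_subgraph)
    have "pre_digraph.scc_of (del_verts G S) u = pverts G - S" if "u \<in> pverts G - S" for u
    proof -
      have "(x, y) \<in> arcs_ends (del_verts G S)" if "x \<in> pverts G - S" "y \<in> pverts G - S" "x \<noteq> y" for x y
        using that by (auto simp: del_verts_def arcs_ends_conv arcs image_iff)
      moreover have verts: "verts (del_verts G S) = pverts G - S" by (simp add: del_verts_def)
      ultimately have reach: "reachable (del_verts G S) x y"
        if "x \<in> pverts G - S" "y \<in> pverts G - S" for x y
        using that by (cases "x = y") (simp_all add: D.reachable_adjI)
      have "v \<in> D.scc_of u \<longleftrightarrow> v \<in> pverts G - S" for v
        using reach[of u v] reach[of v u] \<open>u \<in> pverts G - S\<close> D.reachable_in_verts(2)[of u v]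
        unfolding D.scc_of_def verts by blast
      then show ?thesis by blast
    qed
    then have "D.sccs_verts \<subseteq> {pverts G - S}"
      unfolding D.sccs_verts_conv_scc_of by (auto simp: del_verts_def)
    then have "card D.sccs_verts \<le> 1" using card_mono[of "{pverts G - S}"] by auto
    then show False using assms(3) by (simp add: num_components_def D.card_sccs_verts)
  qed
  moreover define X where "X = {ereal (real (card S) / real (num_components (del_verts G S))) | S.
      S \<subseteq> pverts G \<and> num_components (del_verts G S) > 1}"
  ultimately have "ereal t \<le> Min X"
    using assms(1) by (simp add: tough_def toughness_def)
  moreover have "finite X" unfolding X_def using fin by simp
  moreover have "ereal (real (card S) / real (num_components (del_verts G S))) \<in> X"
    using assms(2,3) by (auto simp: X_def)
  ultimately have "ereal t \<le> ereal (real (card S) / real (num_components (del_verts G S)))"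
    by (meson Min_le order_trans)
  then show ?thesis using assms(3) by (simp add: pos_le_divide_eq)
qed

text \<open>Delete the outer boundary of \<open>U\<close>: the components of the graph induced on
  \<open>U\<close> become components of the rest. If there are at least two, toughness even gives
  the bound without the \<open>+ 1\<close>. If there is only one, a nonempty boundary suffices, and
  connectedness provides it.\<close>

lemma tough_expansion:
  assumes con: "Digraph_Component.connected (with_proj G)" and tough: "tough t G" "2 \<le> t"
    and U: "U \<subset> pverts G" "U \<noteq> {}"
  shows "2 * card (components {e \<in> uedges G. e \<subseteq> U} U) \<le>
    card {v \<in> pverts G - U. \<exists>u\<in>U. {u, v} \<in> uedges G} + 1"
proof -
  let ?B = "{v \<in> pverts G - U. \<exists>u\<in>U. {u, v} \<in> uedges G}"
  let ?A = "{e \<in> uedges G. e \<subseteq> U}"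
  let ?c = "card (components ?A U)"
  have finB: "finite ?B" using pair_finite_verts by simp
  have "?B \<noteq> {}"
  proof
    assume none: "?B = {}"
    obtain u w where uw: "u \<in> U" "w \<in> pverts G" "w \<notin> U" using U by blast
    then have "(u, w) \<in> joined (uedges G)" using U by (intro connected_joined con) auto
    then have "w \<in> U"
    proof (rule joined_closed)
      fix x y assume "{x, y} \<in> uedges G" "x \<in> U"
      moreover from this have "y \<in> pverts G" by (simp add: uedge_verts)
      ultimately show "y \<in> U" using none by blast
    qed (rule uw)
    then show False using uw by simp
  qed
  then have B1: "1 \<le> card ?B" using finB by (simp add: Suc_le_eq card_gt_0_iff)
  show ?thesis
  proof (cases "?c \<le> 1")
    case False
    let ?D = "del_verts G ?B"
    interpret D: wf_digraph ?D unfolding del_verts_def by (rule wellformed_induce_subgraph)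
    have arcsD: "(x, y) \<in> arcs_ends ?D \<longleftrightarrow> {x, y} \<in> uedges G \<and> x \<notin> ?B \<and> y \<notin> ?B" for x y
      using arc_fst_in_verts[of "(x, y)"] arc_snd_in_verts[of "(x, y)"] unfolding uedge_iff
      by (auto simp: del_verts_def arcs_ends_conv image_iff)
    have vertsD: "verts ?D = pverts G - ?B" by (simp add: del_verts_def)
    \<comment> \<open>A path from \<open>U\<close> that avoids the boundary cannot leave
      \<open>U\<close>.\<close>
    have reach: "reachable ?D u y \<longleftrightarrow> (u, y) \<in> joined ?A" if u: "u \<in> U" for u y
    proof
      assume "reachable ?D u y"
      then have "(u, y) \<in> joined ?A \<and> y \<in> U"
      proof (induction rule: D.reachable_induct)
        case (step x y)
        then have "{x, y} \<in> uedges G" "y \<notin> ?B" "x \<in> U" unfolding arcsD by blast+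
        moreover from this have "y \<in> pverts G" by (simp add: uedge_verts)
        ultimately have "y \<in> U" "{x, y} \<in> ?A" by auto
        then show ?case using step.IH by (meson joined_trans joined_edge)
      qed (use u in simp)
      then show "(u, y) \<in> joined ?A" ..
    next
      assume "(u, y) \<in> joined ?A"
      then show "reachable ?D u y" unfolding joined_def
      proof (induction rule: rtrancl_induct)
        case base
        show ?case using u U(1) by (intro D.reachable_refl) (unfold vertsD, auto)
      next
        case (step x y)
        then have "(x, y) \<in> arcs_ends ?D" unfolding arcsD by auto
        then show ?case using step.IH by (rule D.reachable_adj_trans[rotated])
      qed
    qed
    have "components ?A U \<subseteq> D.sccs_verts"
    proof
      fix X assume "X \<in> components ?A U"
      then obtain u where u: "u \<in> U" "X = joined ?A `` {u}" by (auto simp: components_def)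
      have "y \<in> U" if "(u, y) \<in> joined ?A" for y
        using that u(1) by (rule joined_closed) auto
      then have "y \<in> D.scc_of u \<longleftrightarrow> (u, y) \<in> joined ?A" for y
        unfolding D.scc_of_def using u(1) reach[of u y] reach[of y u] joined_sym[of u y] by blast
      then have "X = D.scc_of u" using u(2) by blast
      moreover have "u \<in> verts ?D" unfolding vertsD using u U by auto
      ultimately show "X \<in> D.sccs_verts" using D.scc_of_in_sccs_verts by blast
    qed
    moreover have "finite D.sccs_verts"
      unfolding D.sccs_verts_conv_scc_of vertsD using pair_finite_verts by simp
    ultimately have le: "?c \<le> num_components ?D"
      unfolding num_components_def D.card_sccs_verts[symmetric] by (rule card_mono[rotated])
    then have "t * real (num_components ?D) \<le> real (card ?B)"
      using False by (intro tough_num_components tough) auto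
    moreover have "2 * real ?c \<le> t * real (num_components ?D)"
      using le tough(2) by (intro mult_mono) auto
    ultimately show ?thesis by simp
  qed (use B1 in simp)
qed

section \<open>Light trees, tree degrees and curvature\<close>

lemma light_spanning_tree:
  fixes l :: "'a \<Rightarrow> real"
  assumes con: "Digraph_Component.connected (with_proj G)" and tough: "tough t G" "2 \<le> t"
    and l: "\<And>v. v \<in> pverts G \<Longrightarrow> 0 \<le> l v"
  shows "\<exists>T\<in>spanning_trees G. \<forall>w\<in>pverts G. l w \<le> 2 * sum l (pverts G) - (\<Sum>e\<in>T. sum l e)"
proof -
  let ?V = "pverts G"
  define a where "a = Max (l ` ?V)"
  have ne: "?V \<noteq> {}"
    using con unfolding Digraph_Component.connected_def strongly_connected_def by simp
  have fin: "finite ?V" by (rule pair_finite_verts)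
  have a: "a \<in> l ` ?V" unfolding a_def using fin ne by (intro Max_in) auto
  have le: "l v \<le> a" if "v \<in> ?V" for v unfolding a_def using fin that by simp
  have a0: "0 \<le> a" using a l by auto
  have E: "{e \<in> uedges G. e \<subseteq> ?V} = uedges G" using uedgesE by blast
  have "\<exists>F. edge_forest F \<and> F \<subseteq> {e \<in> uedges G. e \<subseteq> ?V} \<and> joined F = joined {e \<in> uedges G. e \<subseteq> ?V} \<and>
    2 * a * (real (card ?V) - real (card F)) - a \<le>
      2 * sum l ?V - (\<Sum>e\<in>F. sum l e) +
      (\<Sum>v\<in>?V - ?V. a - Min (insert a (l ` {u \<in> ?V. {u, v} \<in> uedges G})))"
    using fin uedgesE l tough_expansion[OF con tough] subset_refl a0 le _ a
    by (rule light_forest) auto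
  then obtain F where F: "edge_forest F" "F \<subseteq> uedges G" "joined F = joined (uedges G)"
    and bound: "2 * a * (real (card ?V) - real (card F)) - a \<le> 2 * sum l ?V - (\<Sum>e\<in>F. sum l e)"
    unfolding E by auto
  have "card (components F ?V) + card F = card ?V"
    using F uedgesE fin by (intro card_edge_forest) blast+
  moreover have "card (components F ?V) > 0"
    using ne fin by (simp add: components_def card_gt_0_iff)
  ultimately have "1 \<le> real (card ?V) - real (card F)" by linarith
  then have "2 * a * 1 \<le> 2 * a * (real (card ?V) - real (card F))"
    using a0 by (intro mult_left_mono) auto
  then have "a \<le> 2 * sum l ?V - (\<Sum>e\<in>F. sum l e)" using bound by simp
  then show ?thesis using spanning_treeI[OF con F] le by (meson order_trans)
qed

lemma sum_edges_conv_degree: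
  fixes l :: "'a \<Rightarrow> real"
  assumes "T \<subseteq> uedges G"
  shows "(\<Sum>e\<in>T. sum l e) = (\<Sum>v\<in>pverts G. l v * real (card {e \<in> T. v \<in> e}))"
proof -
  have fin: "finite T" "finite (pverts G)"
    using pair_finite_verts uedgesE assms by (auto intro!: finite_subset[of T "Pow (pverts G)"])
  have "(\<Sum>e\<in>T. sum l e) = (\<Sum>e\<in>T. \<Sum>v\<in>pverts G. if v \<in> e then l v else 0)"
  proof (rule sum.cong)
    fix e assume "e \<in> T"
    then have "e = pverts G \<inter> e" using uedgesE assms by blast
    then show "sum l e = (\<Sum>v\<in>pverts G. if v \<in> e then l v else 0)"
      using sum.inter_restrict[OF fin(2), of l e] by simp
  qed simp
  also have "\<dots> = (\<Sum>v\<in>pverts G. \<Sum>e\<in>T. if v \<in> e then l v else 0)" by (rule sum.swap)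
  also have "\<dots> = (\<Sum>v\<in>pverts G. l v * real (card {e \<in> T. v \<in> e}))"
    using fin(1) by (intro sum.cong) (simp_all add: sum.If_cases Int_def mult.commute)
  finally show ?thesis .
qed

text \<open>Double counting: a tree occurs once for each of its edges at \<open>v\<close>. The sum
  is thus the mean degree of \<open>v\<close> in a random weighted spanning tree, and positive
  curvature means that this mean is below 2.\<close>

lemma sum_relative_resistance:
  "(\<Sum>e\<in>{e \<in> uedges G. v \<in> e}. relative_resistance G c e) =
    (\<Sum>T\<in>spanning_trees G. (\<Prod>h\<in>T. c h) * real (card {e \<in> T. v \<in> e})) /
    (\<Sum>T\<in>spanning_trees G. \<Prod>h\<in>T. c h)"
proof -
  have finE: "finite (uedges G)"
    using pair_finite_verts uedgesE by (auto intro!: finite_subset[of "uedges G" "Pow (pverts G)"])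
  have finT: "finite (spanning_trees G)"
    by (rule finite_subset[of _ "Pow (uedges G)"]) (auto simp: spanning_trees_def finE)
  let ?E = "{e \<in> uedges G. v \<in> e}"
  have "(\<Sum>e\<in>?E. \<Sum>T\<in>{T \<in> spanning_trees G. e \<in> T}. \<Prod>h\<in>T. c h) =
      (\<Sum>e\<in>?E. \<Sum>T\<in>spanning_trees G. if e \<in> T then \<Prod>h\<in>T. c h else 0)"
    using finT by (simp add: sum.If_cases Int_def)
  also have "\<dots> = (\<Sum>T\<in>spanning_trees G. \<Sum>e\<in>?E. if e \<in> T then \<Prod>h\<in>T. c h else 0)"
    by (rule sum.swap)
  also have "\<dots> = (\<Sum>T\<in>spanning_trees G. (\<Prod>h\<in>T. c h) * real (card {e \<in> T. v \<in> e}))"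
  proof (rule sum.cong)
    fix T assume "T \<in> spanning_trees G"
    then have "?E \<inter> {e. e \<in> T} = {e \<in> T. v \<in> e}" by (auto simp: spanning_trees_def)
    then show "(\<Sum>e\<in>?E. if e \<in> T then \<Prod>h\<in>T. c h else 0) =
        (\<Prod>h\<in>T. c h) * real (card {e \<in> T. v \<in> e})"
      using finE by (simp add: sum.If_cases)
  qed simp
  finally show ?thesis
    by (simp add: relative_resistance_def sum_divide_distrib[symmetric])
qed

theorem tough_imp_resistance_positive:
  assumes con: "Digraph_Component.connected (with_proj G)" and tough: "tough t G" "2 \<le> t"
  shows "resistance_positive G"
proof -
  let ?V = "pverts G" and ?N = "spanning_trees G"
  let ?d = "\<lambda>T v. real (card {e \<in> T. v \<in> e})"
  have finE: "finite (uedges G)"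
    using pair_finite_verts uedgesE by (auto intro!: finite_subset[of "uedges G" "Pow ?V"])
  have NE: "T \<subseteq> uedges G" if "T \<in> ?N" for T using that by (simp add: spanning_trees_def)
  have finN: "finite ?N" by (rule finite_subset[of _ "Pow (uedges G)"]) (use NE finE in auto)
  have light: "\<exists>T\<in>?N. \<forall>w\<in>?V. l w \<le> (\<Sum>v\<in>?V. l v * (2 - ?d T v))"
    if nonneg: "\<And>v. v \<in> ?V \<Longrightarrow> 0 \<le> l v" for l :: "'a \<Rightarrow> real"
  proof -
    obtain T where T: "T \<in> ?N" "\<forall>w\<in>?V. l w \<le> 2 * sum l ?V - (\<Sum>e\<in>T. sum l e)"
      using light_spanning_tree[OF con tough, of l] nonneg by blast
    have "2 * sum l ?V - (\<Sum>e\<in>T. sum l e) = (\<Sum>v\<in>?V. l v * (2 - ?d T v))"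
      unfolding sum_edges_conv_degree[OF NE[OF T(1)]]
      by (simp add: right_diff_distrib sum_subtractf sum_distrib_left mult.commute)
    then show ?thesis using T by auto
  qed
  have "\<exists>l. \<forall>v\<in>?V. (\<Sum>T\<in>?N. exp (- (\<Sum>u\<in>?V. l u * ?d T u)) * ?d T v) <
      2 * (\<Sum>T\<in>?N. exp (- (\<Sum>u\<in>?V. l u * ?d T u)))"
    using pair_finite_verts finN light by (rule exp_weights_mean_less_2)
  then obtain l where l: "\<forall>v\<in>?V. (\<Sum>T\<in>?N. exp (- (\<Sum>u\<in>?V. l u * ?d T u)) * ?d T v) <
      2 * (\<Sum>T\<in>?N. exp (- (\<Sum>u\<in>?V. l u * ?d T u)))" ..
  define c where "c e = exp (- sum l e)" for e
  have c: "(\<Prod>h\<in>T. c h) = exp (- (\<Sum>u\<in>?V. l u * ?d T u))" if "T \<in> ?N" for T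
    unfolding sum_edges_conv_degree[OF NE[OF that], symmetric] c_def
    using finite_subset[OF NE[OF that] finE] by (simp add: exp_sum sum_negf[symmetric])
  have "resistance_curvature G c v > 0" if v: "v \<in> ?V" for v
  proof -
    let ?Z = "\<Sum>T\<in>?N. \<Prod>h\<in>T. c h"
    have lt: "(\<Sum>T\<in>?N. (\<Prod>h\<in>T. c h) * ?d T v) < 2 * ?Z" using l v by (simp add: c)
    moreover have "0 \<le> (\<Sum>T\<in>?N. (\<Prod>h\<in>T. c h) * ?d T v)" by (intro sum_nonneg) (simp add: c)
    \<comment> \<open>Positivity of the total weight is read off the strict inequality, whose left
      side is nonnegative.\<close>
    ultimately have "0 < ?Z" by linarith
    then show ?thesis
      using lt by (simp add: resistance_curvature_def sum_relative_resistance field_simps)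
  qed
  moreover have "c e > 0" for e by (simp add: c_def)
  ultimately show ?thesis unfolding resistance_positive_def by blast
qed

end

theorem corollary5:
  fixes G :: "'a pair_pre_digraph"
  assumes "pair_graph G"
    and "Digraph_Component.connected (with_proj G)"
    and "tough 10 G"
  shows "resistance_positive G"
  using assms by (intro pair_graph.tough_imp_resistance_positive[of G 10]) auto

end
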